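(* Let $A$ be a non-negative $n\times n$ real matrix and let $d=[d_1,\dots,d_n]^T\ge 0$. The following statements are equivalent: (i) The system $(I-A)x=d$ has an economically meaningful solution, i.e. a solution $x>0$. (ii) $A=MC$, where $M=[m_{ij}]_{1\le i,j\le n}$ and $C=[c_{ij}]_{1\le i,j\le n}$ are non-negative square matrices such that $C$ is diagonal and, for every $i=1,\dots,n$, $$m_{i1}+\cdots+m_{in}+d_i>0\quad\text{and}\quad c_{ii}=\frac{1}{m_{i1}+\cdots+m_{in}+d_i}.$$ Moreover, if either of these two statements holds, then $\rho(A)\le 1$.
   Context: For a real vector or matrix $C$, $C\ge 0$ (non-negative) means all entries are $\ge 0$, and $C>0$ (positive) means all entries are $>0$. $\rho$ denotes the spectral radius. A solution $x$ is economically meaningful if $x>0$. *)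

theory Defs
  imports "Jordan_Normal_Form.Spectral_Radius"
begin

definition nonneg_mat :: "real mat \<Rightarrow> bool" where
  "nonneg_mat B \<longleftrightarrow> (\<forall>i < dim_row B. \<forall>j < dim_col B. B $$ (i, j) \<ge> 0)"

definition nonneg_vec :: "real vec \<Rightarrow> bool" where
  "nonneg_vec v \<longleftrightarrow> (\<forall>i < dim_vec v. v $ i \<ge> 0)"

(* The library order 0\<^sub>v n < v only says that v is non-negative and nonzero. *)
definition pos_vec :: "real vec \<Rightarrow> bool" where
  "pos_vec v \<longleftrightarrow> (\<forall>i < dim_vec v. v $ i > 0)"

definition has_meaningful_solution :: "nat \<Rightarrow> real mat \<Rightarrow> real vec \<Rightarrow> bool" where
  "has_meaningful_solution n A d \<longleftrightarrow>
     (\<exists>x \<in> carrier_vec n. (1\<^sub>m n - A) *\<^sub>v x = d \<and> pos_vec x)"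

definition has_normalized_factorization :: "nat \<Rightarrow> real mat \<Rightarrow> real vec \<Rightarrow> bool" where
  "has_normalized_factorization n A d \<longleftrightarrow>
     (\<exists>M \<in> carrier_mat n n. \<exists>C \<in> carrier_mat n n.
        nonneg_mat M \<and> nonneg_mat C \<and> diagonal_mat C \<and> A = M * C \<and>
        (\<forall>i < n. (\<Sum>j<n. M $$ (i, j)) + d $ i > 0 \<and>
                 C $$ (i, i) = 1 / ((\<Sum>j<n. M $$ (i, j)) + d $ i)))"

(* The library's spectral radius is defined for complex matrices, as the maximal
   modulus of an eigenvalue. *)
definition real_spectral_radius :: "real mat \<Rightarrow> real" where
  "real_spectral_radius B = spectral_radius (map_mat complex_of_real B)"

end

theory Submission
  imports Defs
begin

text \<open>
  The two conditions are linked by the substitution \<open>M = A * diag x\<close>, \<open>C = diag (1/x)\<close>. A vector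
  \<open>x > 0\<close> solves \<open>(I - A) x = d\<close> exactly when \<open>x = A x + d\<close>, and \<open>(A x)\<^sub>i\<close> is the \<open>i\<close>-th row sum of
  \<open>A * diag x\<close>; hence the numbers \<open>1 / c\<^sub>i\<^sub>i\<close> of a factorization are the coordinates of a positive
  solution, and conversely.

  For the bound on the spectral radius, a positive solution satisfies \<open>A x = x - d \<le> x\<close>. The lemma
  \<open>spectral_radius_le_of_subinvariant\<close> shows that a positive vector with \<open>|B| x \<le> c x\<close> forces
  \<open>\<rho>(B) \<le> c\<close>: the row of an eigenvector equation \<open>B v = \<lambda> v\<close> in which \<open>|v\<^sub>i| / x\<^sub>i\<close> is largest
  gives \<open>|\<lambda>| \<le> c\<close>.
\<close>

lemma mult_mat_vec_nth_sum:
  assumes "A \<in> carrier_mat m n" "v \<in> carrier_vec n" "i < m"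
  shows "(A *\<^sub>v v) $ i = (\<Sum>j<n. A $$ (i, j) * v $ j)"
  using assms by (auto simp: scalar_prod_def atLeast0LessThan intro!: sum.cong)

lemma mult_diagonal_mat_nth:
  fixes M C :: "'a :: semiring_0 mat"
  assumes M: "M \<in> carrier_mat m n" and C: "C \<in> carrier_mat n n" and diag: "diagonal_mat C"
    and "i < m" "j < n"
  shows "(M * C) $$ (i, j) = M $$ (i, j) * C $$ (j, j)"
proof -
  have "(M * C) $$ (i, j) = (\<Sum>k<n. M $$ (i, k) * C $$ (k, j))"
    using assms by (auto simp: scalar_prod_def atLeast0LessThan intro!: sum.cong)
  also have "\<dots> = (\<Sum>k<n. if k = j then M $$ (i, j) * C $$ (j, j) else 0)"
    using C diag \<open>j < n\<close> by (intro sum.cong) (auto simp: diagonal_mat_def)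
  also have "\<dots> = M $$ (i, j) * C $$ (j, j)"
    using \<open>j < n\<close> by simp
  finally show ?thesis .
qed

text \<open>A weighted form of the bound of the spectral radius by the maximal absolute row sum.\<close>

lemma spectral_radius_le_of_subinvariant:
  fixes B :: "complex mat" and x :: "nat \<Rightarrow> real"
  assumes n: "n > 0" and B: "B \<in> carrier_mat n n"
    and pos: "\<And>i. i < n \<Longrightarrow> x i > 0"
    and sub: "\<And>i. i < n \<Longrightarrow> (\<Sum>j<n. cmod (B $$ (i, j)) * x j) \<le> c * x i"
  shows "spectral_radius B \<le> c"
proof -
  obtain ev where ev: "eigenvalue B ev" and rho: "spectral_radius B = cmod ev"
    using spectral_radius_mem_max(1)[OF B n] unfolding spectrum_def by auto
  obtain v where v: "v \<in> carrier_vec n" "v \<noteq> 0\<^sub>v n" and eq: "B *\<^sub>v v = ev \<cdot>\<^sub>v v"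
    using ev B unfolding eigenvalue_def eigenvector_def by auto
  let ?r = "\<lambda>i. cmod (v $ i) / x i"
  define t where "t = Max (?r ` {..<n})"
  have "t \<in> ?r ` {..<n}"
    unfolding t_def using n by (intro Max_in) auto
  then obtain k where k: "k < n" and t: "t = ?r k" by auto
  have le: "cmod (v $ j) \<le> t * x j" if "j < n" for j
  proof -
    have "?r j \<le> t" unfolding t_def using that by (intro Max_ge) auto
    then show ?thesis using pos[OF that] by (simp add: field_simps)
  qed
  obtain l where l: "l < n" "v $ l \<noteq> 0"
    using v eq_vecI[of v "0\<^sub>v n"] by auto
  have "0 < t * x l"
    using le[OF l(1)] l(2) by (meson less_le_trans zero_less_norm_iff)
  then have t_pos: "t > 0"
    using pos[OF l(1)] by (simp add: zero_less_mult_iff)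
  have vk: "cmod (v $ k) = t * x k"
    using pos[OF k] by (simp add: t)
  have "cmod ev * (t * x k) = cmod ((B *\<^sub>v v) $ k)"
    using v k unfolding eq by (simp add: norm_mult vk)
  also have "\<dots> = cmod (\<Sum>j<n. B $$ (k, j) * v $ j)"
    by (simp only: mult_mat_vec_nth_sum[OF B v(1) k])
  also have "\<dots> \<le> (\<Sum>j<n. cmod (B $$ (k, j)) * (t * x j))"
    by (intro sum_norm_le) (auto simp: norm_mult intro!: mult_left_mono le)
  also have "\<dots> = t * (\<Sum>j<n. cmod (B $$ (k, j)) * x j)"
    by (simp add: sum_distrib_left mult_ac)
  also have "\<dots> \<le> t * (c * x k)"
    using sub[OF k] t_pos by (intro mult_left_mono) auto
  also have "\<dots> = c * (t * x k)" by simp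
  finally have "cmod ev * (t * x k) \<le> c * (t * x k)" .
  moreover have "t * x k > 0" using t_pos pos[OF k] by simp
  ultimately show ?thesis unfolding rho by (rule mult_right_le_imp_le)
qed

lemma has_meaningful_solution_iff:
  assumes A: "A \<in> carrier_mat n n" and d: "d \<in> carrier_vec n"
  shows "has_meaningful_solution n A d \<longleftrightarrow>
    (\<exists>x. \<forall>i<n. x i > 0 \<and> (\<Sum>j<n. A $$ (i, j) * x j) + d $ i = x i)"
    (is "_ \<longleftrightarrow> ?R")
proof -
  have eq_iff: "(1\<^sub>m n - A) *\<^sub>v x = d \<longleftrightarrow> (\<forall>i<n. (\<Sum>j<n. A $$ (i, j) * x $ j) + d $ i = x $ i)"
    if x: "x \<in> carrier_vec n" for x
  proof -
    have "((1\<^sub>m n - A) *\<^sub>v x) $ i = x $ i - (\<Sum>j<n. A $$ (i, j) * x $ j)" if "i < n" for i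
    proof -
      have "(1\<^sub>m n - A) *\<^sub>v x = x - A *\<^sub>v x"
        using minus_mult_distrib_mat_vec[OF one_carrier_mat A x] x by simp
      then show ?thesis
        using A x that mult_mat_vec_nth_sum[OF A x that] by simp
    qed
    moreover have "(1\<^sub>m n - A) *\<^sub>v x = d \<longleftrightarrow> (\<forall>i<n. ((1\<^sub>m n - A) *\<^sub>v x) $ i = d $ i)"
      using A d by (auto intro!: eq_vecI)
    moreover have "a - b = c \<longleftrightarrow> b + c = a" for a b c :: real by auto
    ultimately show ?thesis by simp
  qed
  show ?thesis
  proof
    assume "has_meaningful_solution n A d"
    then obtain x where x: "x \<in> carrier_vec n" "(1\<^sub>m n - A) *\<^sub>v x = d" "pos_vec x"
      unfolding has_meaningful_solution_def by blast
    then have "\<forall>i<n. x $ i > 0 \<and> (\<Sum>j<n. A $$ (i, j) * x $ j) + d $ i = x $ i"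
      using iffD1[OF eq_iff[OF x(1)] x(2)] by (simp add: pos_vec_def)
    then show ?R by blast
  next
    assume ?R
    then obtain x where x: "\<forall>i<n. x i > 0 \<and> (\<Sum>j<n. A $$ (i, j) * x j) + d $ i = x i"
      by blast
    have "(1\<^sub>m n - A) *\<^sub>v vec n x = d"
      using x by (subst eq_iff) auto
    moreover have "pos_vec (vec n x)" using x by (simp add: pos_vec_def)
    ultimately show "has_meaningful_solution n A d"
      unfolding has_meaningful_solution_def by (auto intro!: bexI[of _ "vec n x"])
  qed
qed

lemma has_normalized_factorization_iff:
  assumes A: "A \<in> carrier_mat n n" and nonneg: "nonneg_mat A"
  shows "has_normalized_factorization n A d \<longleftrightarrow>
    (\<exists>x. \<forall>i<n. x i > 0 \<and> (\<Sum>j<n. A $$ (i, j) * x j) + d $ i = x i)"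
    (is "_ \<longleftrightarrow> ?R")
proof
  assume "has_normalized_factorization n A d"
  then obtain M C where M: "M \<in> carrier_mat n n" and C: "C \<in> carrier_mat n n"
    and diag: "diagonal_mat C" and AMC: "A = M * C"
    and rows: "\<And>i. i < n \<Longrightarrow> (\<Sum>j<n. M $$ (i, j)) + d $ i > 0"
    and Cii: "\<And>i. i < n \<Longrightarrow> C $$ (i, i) = 1 / ((\<Sum>j<n. M $$ (i, j)) + d $ i)"
    unfolding has_normalized_factorization_def by blast
  define x where "x i = (\<Sum>j<n. M $$ (i, j)) + d $ i" for i
  have "A $$ (i, j) * x j = M $$ (i, j)" if "i < n" "j < n" for i j
    using mult_diagonal_mat_nth[OF M C diag that] rows[OF that(2)] Cii[OF that(2)]
    by (simp add: AMC x_def)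
  then have "\<forall>i<n. x i > 0 \<and> (\<Sum>j<n. A $$ (i, j) * x j) + d $ i = x i"
    using rows by (simp add: x_def)
  then show ?R by blast
next
  assume ?R
  then obtain x where pos: "\<And>i. i < n \<Longrightarrow> x i > 0"
    and x: "\<And>i. i < n \<Longrightarrow> (\<Sum>j<n. A $$ (i, j) * x j) + d $ i = x i"
    by blast
  define M where "M = mat n n (\<lambda>(i, j). A $$ (i, j) * x j)"
  define C where "C = mat n n (\<lambda>(i, j). if i = j then 1 / x i else 0)"
  have M: "M \<in> carrier_mat n n" and C: "C \<in> carrier_mat n n"
    by (simp_all add: M_def C_def)
  have diag: "diagonal_mat C" by (simp add: diagonal_mat_def C_def)
  have "nonneg_mat M" "nonneg_mat C"
    using nonneg A pos by (auto simp: nonneg_mat_def M_def C_def less_imp_le)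
  moreover have "A = M * C"
  proof (rule eq_matI)
    fix i j assume "i < dim_row (M * C)" "j < dim_col (M * C)"
    then have ij: "i < n" "j < n" using M C by auto
    show "A $$ (i, j) = (M * C) $$ (i, j)"
      using mult_diagonal_mat_nth[OF M C diag ij] pos[OF ij(2)] ij by (simp add: M_def C_def)
  qed (use A M C in auto)
  moreover have "(\<Sum>j<n. M $$ (i, j)) + d $ i = x i" if "i < n" for i
    using x[OF that] that by (simp add: M_def)
  ultimately show "has_normalized_factorization n A d"
    unfolding has_normalized_factorization_def using M C diag pos
    by (intro bexI[of _ M] bexI[of _ C]) (auto simp: C_def)
qed

theorem lemma1:
  fixes n :: nat and A :: "real mat" and d :: "real vec"
  assumes "n > 0"
    and "A \<in> carrier_mat n n" and "nonneg_mat A"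
    and "d \<in> carrier_vec n" and "nonneg_vec d"
  shows "(has_meaningful_solution n A d \<longleftrightarrow> has_normalized_factorization n A d) \<and>
         (has_meaningful_solution n A d \<or> has_normalized_factorization n A d \<longrightarrow>
            real_spectral_radius A \<le> 1)"
proof -
  note sol_iff = has_meaningful_solution_iff[OF assms(2,4)]
  have iff: "has_meaningful_solution n A d \<longleftrightarrow> has_normalized_factorization n A d"
    unfolding sol_iff has_normalized_factorization_iff[OF assms(2,3)] ..
  have "real_spectral_radius A \<le> 1" if "has_meaningful_solution n A d"
  proof -
    obtain x where pos: "\<And>i. i < n \<Longrightarrow> x i > 0"
      and x: "\<And>i. i < n \<Longrightarrow> (\<Sum>j<n. A $$ (i, j) * x j) + d $ i = x i"
      using \<open>has_meaningful_solution n A d\<close> unfolding sol_iff by blast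
    have "(\<Sum>j<n. cmod (map_mat complex_of_real A $$ (i, j)) * x j) \<le> 1 * x i" if "i < n" for i
    proof -
      have "(\<Sum>j<n. cmod (map_mat complex_of_real A $$ (i, j)) * x j) = (\<Sum>j<n. A $$ (i, j) * x j)"
        using assms(2,3) that by (intro sum.cong) (auto simp: nonneg_mat_def)
      also have "\<dots> \<le> x i"
        using x[OF that] assms(4,5) that by (auto simp: nonneg_vec_def)
      finally show ?thesis by simp
    qed
    then show ?thesis
      unfolding real_spectral_radius_def
      using assms(1,2) pos by (intro spectral_radius_le_of_subinvariant[where x = x]) auto
  qed
  with iff show ?thesis by blast
qed

end
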